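(* Let $L\ge 1$ and let $B=(b_1,\dots,b_L)$ be a sequence of integers $b_i\ge 2$. The rejection sampler $\mathcal{S}(B)$, run on a source $\mathcal{R}$ of independent uniform random bits, terminates with probability $1$ and outputs a tuple $K=(k_1,\dots,k_L)$ that is uniformly distributed on $\mathcal{K}=\prod_{i=1}^L\{0,\dots,b_i-1\}$ with mutually independent digits $k_1,\dots,k_L$.
   Context: Let $P=\prod_{i=1}^L b_i$ and $k=\lceil\log_2 P\rceil$. The rejection sampler $\mathcal{S}(B)$: (1) draw $k$ fresh bits from $\mathcal{R}$ and interpret them as an integer $V\in\{0,\dots,2^k-1\}$; (2) if $V\ge P$, discard $V$ and return to step 1; (3) otherwise apply the inverse Horner decomposition to $V$ and return the resulting tuple. Inverse Horner decomposition of $V\in\{0,\dots,P-1\}$: set $V^{(L)}=V$ and, for $i=L,\dots,1$, set $k_i=V^{(i)}\bmod b_i$ and $V^{(i-1)}=\lfloor V^{(i)}/b_i\rfloor$; the output is $(k_1,\dots,k_L)$. *)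

theory Defs
  imports "HOL-Probability.Probability"
begin

definition num_tuples :: "(nat \<Rightarrow> nat) \<Rightarrow> nat \<Rightarrow> nat" where
  "num_tuples b L = (\<Prod>i = 1..L. b i)"

definition block_length :: "(nat \<Rightarrow> nat) \<Rightarrow> nat \<Rightarrow> nat" where
  "block_length b L = nat \<lceil>log 2 (real (num_tuples b L))\<rceil>"

(* Binary value of the k bits r pos, ..., r (pos + k - 1); the first bit is the most significant. *)
definition bits_value :: "(nat \<Rightarrow> bool) \<Rightarrow> nat \<Rightarrow> nat \<Rightarrow> nat" where
  "bits_value r pos k = horner_sum of_bool 2 (rev (map r [pos..<pos + k]))"

(* In the recursive call the last argument is the V^(i) of the decomposition.
   Tuples are indexed by {1..L} and are undefined outside it, as in Pi\<^sub>E. *)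
primrec inverse_horner :: "(nat \<Rightarrow> nat) \<Rightarrow> nat \<Rightarrow> nat \<Rightarrow> (nat \<Rightarrow> nat)" where
  "inverse_horner b 0 V = (\<lambda>_. undefined)"
| "inverse_horner b (Suc i) V =
     (inverse_horner b i (V div b (Suc i))) (Suc i := V mod b (Suc i))"

(* r is the realised bit sequence and pos the number of bits already consumed.
   By the least-fixed-point semantics, None means exactly that the loop does not terminate. *)
partial_function (option) rejection_loop ::
    "(nat \<Rightarrow> nat) \<Rightarrow> nat \<Rightarrow> (nat \<Rightarrow> bool) \<Rightarrow> nat \<Rightarrow> (nat \<Rightarrow> nat) option" where
  "rejection_loop b L r pos =
     (let k = block_length b L; V = bits_value r pos k
      in if V \<ge> num_tuples b L then rejection_loop b L r (pos + k)
         else Some (inverse_horner b L V))"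

definition rejection_sampler ::
    "(nat \<Rightarrow> nat) \<Rightarrow> nat \<Rightarrow> (nat \<Rightarrow> bool) \<Rightarrow> (nat \<Rightarrow> nat) option" where
  "rejection_sampler b L r = rejection_loop b L r 0"

end

theory Submission imports Defs begin

text \<open>
  The successive blocks of \<open>k\<close> bits are independent and uniform on \<open>{..<2 ^ k}\<close>. For each \<open>x < P\<close>, the
  first block value below \<open>P\<close> occurs in block \<open>n\<close> and equals \<open>x\<close> with probability
  \<open>(1 - P / 2 ^ k) ^ n / 2 ^ k\<close>. Summed over \<open>n\<close> this gives \<open>1 / P\<close>; these values already add up to 1,
  so the loop stops almost surely. Inverse Horner decomposition is a bijection onto the tuples, and
  the uniform distribution on a product set is a product distribution.
\<close>

section \<open>Rejection of independent uniform draws\<close>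

text \<open>\<open>None\<close> marks a sequence that never enters \<open>A\<close>, just as
  \<open>None\<close> marks a loop that never stops. The sampler is reduced to this construction,
  which no longer mentions bits.\<close>

definition first_in :: "'b set \<Rightarrow> (nat \<Rightarrow> 'b) \<Rightarrow> 'b option" where
  "first_in A v = (if \<exists>n. v n \<in> A then Some (v (LEAST n. v n \<in> A)) else None)"

lemma first_in_eq_None_iff: "first_in A v = None \<longleftrightarrow> (\<forall>n. v n \<notin> A)"
  by (simp add: first_in_def)

lemma first_in_eqI:
  assumes "v n \<in> A" "\<And>m. m < n \<Longrightarrow> v m \<notin> A"
  shows "first_in A v = Some (v n)"
proof -
  have "(LEAST n. v n \<in> A) = n"
    using assms by (intro Least_equality) (auto simp: not_less[symmetric])
  with assms(1) show ?thesis by (auto simp: first_in_def)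
qed

lemma first_in_eq_SomeE:
  assumes "first_in A v = Some x"
  obtains n where "v n = x" "x \<in> A" "\<And>m. m < n \<Longrightarrow> v m \<notin> A"
proof
  let ?n = "LEAST n. v n \<in> A"
  have ex: "\<exists>n. v n \<in> A" and x: "v ?n = x"
    using assms by (auto simp: first_in_def split: if_splits)
  show "v ?n = x" by (fact x)
  show "x \<in> A" using LeastI_ex[OF ex] x by simp
  show "v m \<notin> A" if "m < ?n" for m using not_less_Least[OF that] .
qed

lemma measurable_first_in:
  fixes X :: "nat \<Rightarrow> 'a \<Rightarrow> 'b::countable"
  assumes X: "\<And>n. X n \<in> measurable M (count_space UNIV)"
  shows "(\<lambda>\<omega>. first_in A (\<lambda>n. X n \<omega>)) \<in> measurable M (count_space UNIV)"
proof -
  have [measurable]: "Measurable.pred M (\<lambda>\<omega>. X n \<omega> \<in> A)" for n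
    by (rule measurable_compose[OF X]) simp
  \<comment> \<open>The index is itself random. It takes countably many values, so measurability can
    be checked for each fixed index.\<close>
  have "(\<lambda>\<omega>. Some (X (LEAST n. X n \<omega> \<in> A) \<omega>)) \<in> measurable M (count_space UNIV)"
    by (rule measurable_compose_countable[where f = "\<lambda>n \<omega>. Some (X n \<omega>)"])
       (auto intro: measurable_compose[OF X])
  then show ?thesis
    unfolding first_in_def by measurable
qed

lemma (in prob_space) prob_uniform:
  assumes "X \<in> measurable M (count_space UNIV)" "finite S" "S \<noteq> {}"
    and "distr M (count_space UNIV) X = measure_pmf (pmf_of_set S)"
  shows "prob (X -` A \<inter> space M) = card (S \<inter> A) / card S"
proof -
  have "prob (X -` A \<inter> space M) = measure (distr M (count_space UNIV) X) A"
    using assms(1) by (simp add: measure_distr)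
  then show ?thesis using assms by (simp add: measure_pmf_of_set)
qed

text \<open>Stating the law on the option type captures two facts at once: the accepted value is
  uniform, and \<open>None\<close> has mass 0, so some draw is accepted almost surely.\<close>

theorem (in prob_space) distr_first_in:
  fixes X :: "nat \<Rightarrow> 'a \<Rightarrow> 'b::countable"
  assumes ind: "indep_vars (\<lambda>_. count_space UNIV) X UNIV"
    and S: "finite S" and A: "A \<subseteq> S" "A \<noteq> {}"
    and unif: "\<And>n. distr M (count_space UNIV) (X n) = measure_pmf (pmf_of_set S)"
  shows "distr M (count_space UNIV) (\<lambda>\<omega>. first_in A (\<lambda>n. X n \<omega>)) =
    measure_pmf (pmf_of_set (Some ` A))"
proof -
  let ?Z = "\<lambda>\<omega>. first_in A (\<lambda>n. X n \<omega>)"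
  have X: "X n \<in> measurable M (count_space UNIV)" for n
    using ind by (simp add: indep_vars_def)
  have Z: "?Z \<in> measurable M (count_space UNIV)"
    using X by (rule measurable_first_in)
  have finA: "finite A" using A S finite_subset by blast
  have cA: "card A > 0" using finA A by (simp add: card_gt_0_iff)
  have cS: "card S > 0" using S A by (auto simp: card_gt_0_iff)
  have le: "card A \<le> card S" using A S by (simp add: card_mono)
  have PX: "prob (X n -` B \<inter> space M) = card (S \<inter> B) / card S" for n B
    using prob_uniform[OF X S _ unif] A by auto
  define q where "q = 1 - real (card A) / card S"
  have q: "0 \<le> q" "q < 1" using cA cS le by (auto simp: q_def)
  have pA: "prob (X n -` (- A) \<inter> space M) = q" for n
  proof -
    have "S \<inter> - A = S - A" by auto
    then have "card (S \<inter> - A) = card S - card A" using A finA by (simp add: card_Diff_subset)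
    then show ?thesis using cS le by (simp add: PX q_def of_nat_diff diff_divide_distrib)
  qed
  have pSome: "prob (?Z -` {Some x} \<inter> space M) = 1 / card A" if x: "x \<in> A" for x
  proof -
    \<comment> \<open>\<open>E n\<close> says that draw \<open>n\<close> is the first in
      \<open>A\<close> and equals \<open>x\<close>. Written as an intersection of conditions on
      single draws, its probability factors by independence.\<close>
    define B where "B n i = (if i < n then - A else {x})" for n i :: nat
    define E where "E n = (\<Inter>i\<in>{..n}. X i -` B n i \<inter> space M)" for n
    have E: "E n = {\<omega>\<in>space M. (\<forall>m<n. X m \<omega> \<notin> A) \<and> X n \<omega> = x}" for n
    proof -
      have "{..n} = insert n {..<n}" by auto
      then show ?thesis by (auto simp: E_def B_def)
    qed
    have pE: "prob (E n) = q ^ n * (1 / card S)" for n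
    proof -
      have "prob (E n) = (\<Prod>i\<in>{..n}. prob (X i -` B n i \<inter> space M))"
        unfolding E_def by (rule indep_varsD[OF ind]) auto
      also have "\<dots> = (\<Prod>i<n. prob (X i -` B n i \<inter> space M)) * prob (X n -` B n n \<inter> space M)"
        by (simp add: lessThan_Suc_atMost[symmetric])
      also have "(\<Prod>i<n. prob (X i -` B n i \<inter> space M)) = q ^ n"
        by (simp add: B_def pA)
      also have "prob (X n -` B n n \<inter> space M) = 1 / card S"
        using x A by (auto simp: B_def PX Int_absorb1)
      finally show ?thesis .
    qed
    have un: "?Z -` {Some x} \<inter> space M = (\<Union>n. E n)"
      using x by (auto simp: E intro: first_in_eqI elim!: first_in_eq_SomeE)
    have disj: "disjoint_family E"
    proof (unfold disjoint_family_on_def, safe)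
      fix m n \<omega> assume "m \<noteq> n" "\<omega> \<in> E m" "\<omega> \<in> E n"
      \<comment> \<open>At the smaller of the two indices the draw would equal \<open>x\<close>,
        which lies in \<open>A\<close>, and at the same time be rejected.\<close>
      then show "\<omega> \<in> {}" using x by (cases m n rule: linorder_cases) (auto simp: E)
    qed
    have "range E \<subseteq> events"
      unfolding E_def using X by (auto intro!: sets.finite_INT measurable_sets[OF X])
    from finite_measure_UNION[OF this disj]
    have "(\<lambda>n. prob (E n)) sums prob (?Z -` {Some x} \<inter> space M)" by (simp add: un)
    \<comment> \<open>Geometric series. Since \<open>1 - q\<close> is
      \<open>card A / card S\<close>, the factor \<open>card S\<close> cancels and
      \<open>1 / card A\<close> remains.\<close>
    moreover have "(\<lambda>n. q ^ n * (1 / card S)) sums (1 / (1 - q) * (1 / card S))"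
      using q by (intro sums_mult2 geometric_sums) auto
    ultimately have "prob (?Z -` {Some x} \<inter> space M) = 1 / (1 - q) * (1 / card S)"
      unfolding pE by (rule sums_unique2)
    then show ?thesis using cS by (simp add: q_def)
  qed
  interpret D: prob_space "distr M (count_space UNIV) ?Z"
    using Z by (rule prob_space_distr)
  have D: "D.prob {y} = prob (?Z -` {y} \<inter> space M)" for y
    using Z by (simp add: measure_distr)
  \<comment> \<open>The \<open>card A\<close> point masses \<open>1 / card A\<close> exhaust the
    total mass, so every other outcome, \<open>None\<close> included, is null.\<close>
  have "D.prob (Some ` A) = (\<Sum>y\<in>Some ` A. D.prob {y})"
    using finA by (intro D.finite_measure_eq_sum_singleton) auto
  also have "\<dots> = 1" using cA by (simp add: sum.reindex D pSome)
  finally have full: "D.prob (Some ` A) = 1" .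
  have out: "D.prob {y} = 0" if "y \<notin> Some ` A" for y
  proof -
    have "D.prob {y} \<le> D.prob (UNIV - Some ` A)"
      using that by (intro D.finite_measure_mono) auto
    also have "\<dots> = 0" using D.prob_compl[of "Some ` A"] full by simp
    finally show ?thesis by (simp add: measure_le_0_iff)
  qed
  show ?thesis
  proof (rule measure_eqI_countable[where A = UNIV])
    fix y :: "'b option"
    have "D.prob {y} = pmf (pmf_of_set (Some ` A)) y"
      using finA A out[of y] by (cases "y \<in> Some ` A") (auto simp: D pSome card_image)
    then show "emeasure (distr M (count_space UNIV) ?Z) {y} =
        emeasure (measure_pmf (pmf_of_set (Some ` A))) {y}"
      by (simp add: D.emeasure_eq_measure emeasure_pmf_single)
  qed auto
qed

section \<open>Blocks of random bits\<close>

lemma bits_value_0 [simp]: "bits_value r pos 0 = 0"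
  by (simp add: bits_value_def)

text \<open>\<open>horner_sum\<close> takes the least significant digit first; after
  \<open>rev\<close> the newest bit has weight 1 and all earlier bits are doubled.\<close>

lemma bits_value_Suc:
  "bits_value r pos (Suc k) = of_bool (r (pos + k)) + 2 * bits_value r pos k"
  by (simp add: bits_value_def)

lemma bits_value_less: "bits_value r pos k < 2 ^ k"
  using horner_sum_of_bool_2_less[of "rev (map r [pos..<pos + k])"] by (simp add: bits_value_def)

lemma bits_value_cong:
  assumes "\<And>i. i \<in> {pos..<pos + k} \<Longrightarrow> r i = s i"
  shows "bits_value r pos k = bits_value s pos k"
  unfolding bits_value_def using assms by (intro arg_cong[where f = "\<lambda>xs. horner_sum _ _ (rev xs)"]) auto

text \<open>Turns an event about a block into conditions on its single bits, the form to which
  independence of the bits applies. The first bit is the most significant, so bit \<open>i\<close>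
  has weight \<open>2 ^ (k - Suc i)\<close>.\<close>

lemma bits_value_eq_iff:
  assumes "v < 2 ^ k"
  shows "bits_value r pos k = v \<longleftrightarrow> (\<forall>i<k. r (pos + i) = odd (v div 2 ^ (k - Suc i)))"
  using assms
proof (induction k arbitrary: v)
  case (Suc k)
  \<comment> \<open>The last bit is the parity of \<open>v\<close>, and the earlier bits encode
    \<open>v div 2\<close>.\<close>
  have "bits_value r pos (Suc k) = v \<longleftrightarrow> r (pos + k) = odd v \<and> bits_value r pos k = v div 2"
    unfolding bits_value_Suc by (cases "r (pos + k)"; simp; presburger)
  also have "bits_value r pos k = v div 2 \<longleftrightarrow>
      (\<forall>i<k. r (pos + i) = odd (v div 2 div 2 ^ (k - Suc i)))"
    using Suc.prems by (intro Suc.IH) auto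
  also have "\<dots> \<longleftrightarrow> (\<forall>i<k. r (pos + i) = odd (v div 2 ^ (Suc k - Suc i)))"
  proof (intro all_cong1 imp_cong refl)
    fix i assume "i < k"
    \<comment> \<open>The bound \<open>i < k\<close> keeps the subtraction in the exponent from
      being truncated.\<close>
    then have "(2::nat) ^ (Suc k - Suc i) = 2 * 2 ^ (k - Suc i)"
      by (simp flip: power_Suc add: Suc_diff_Suc)
    then show "(r (pos + i) = odd (v div 2 div 2 ^ (k - Suc i))) =
      (r (pos + i) = odd (v div 2 ^ (Suc k - Suc i)))"
      by (simp add: div_mult2_eq)
  qed
  finally show ?case by (auto simp: less_Suc_eq)
qed auto

lemma measurable_bits_value:
  assumes "\<And>i. i \<in> {pos..<pos + k} \<Longrightarrow> (\<lambda>\<omega>. R \<omega> i) \<in> measurable M (count_space UNIV)"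
  shows "(\<lambda>\<omega>. bits_value (R \<omega>) pos k) \<in> measurable M (count_space UNIV)"
  using assms
proof (induction k)
  case (Suc k)
  have [measurable]: "(\<lambda>\<omega>. bits_value (R \<omega>) pos k) \<in> measurable M (count_space UNIV)"
    by (rule Suc.IH) (use Suc.prems in auto)
  have [measurable]: "(\<lambda>\<omega>. R \<omega> (pos + k)) \<in> measurable M (count_space UNIV)"
    by (rule Suc.prems) auto
  show ?case unfolding bits_value_Suc by measurable
qed auto

locale random_bits = prob_space M for M :: "'a measure" +
  fixes R :: "nat \<Rightarrow> 'a \<Rightarrow> bool"
  assumes indep_bits: "indep_vars (\<lambda>_. count_space UNIV) R UNIV"
    and uniform_bit: "distr M (count_space UNIV) (R n) = measure_pmf (pmf_of_set UNIV)"
begin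

lemma measurable_bit: "R n \<in> measurable M (count_space UNIV)"
  using indep_bits by (simp add: indep_vars_def)

lemma measurable_block:
  "(\<lambda>\<omega>. bits_value (\<lambda>n. R n \<omega>) pos k) \<in> measurable M (count_space UNIV)"
  by (rule measurable_bits_value) (rule measurable_bit)

text \<open>Exactly one pattern of \<open>k\<close> bits has value \<open>v\<close>, and each of the
  independent fair bits matches it with probability 1/2.\<close>

lemma prob_block:
  assumes "v < 2 ^ k"
  shows "prob ((\<lambda>\<omega>. bits_value (\<lambda>n. R n \<omega>) pos k) -` {v} \<inter> space M) = 1 / 2 ^ k"
proof (cases "k = 0")
  \<comment> \<open>An empty block always has value 0, so the event is the whole space. The
    intersection used below requires a nonempty index set.\<close>
  case True
  with assms show ?thesis by (simp add: prob_space)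
next
  case False
  \<comment> \<open>The required bit, indexed by its absolute position \<open>i\<close> in the
    source; hence the shift by \<open>pos\<close>.\<close>
  define B where "B i = {odd (v div 2 ^ (k - Suc (i - pos)))}" for i
  have "(\<lambda>\<omega>. bits_value (\<lambda>n. R n \<omega>) pos k) -` {v} \<inter> space M =
      (\<Inter>i\<in>{pos..<pos + k}. R i -` B i \<inter> space M)" (is "?E = ?F")
  proof (intro set_eqI)
    fix \<omega>
    have "{pos..<pos + k} = (+) pos ` {..<k}"
      by (simp add: lessThan_atLeast0 add.commute)
    then have "(\<forall>i<k. R (pos + i) \<omega> = odd (v div 2 ^ (k - Suc i))) \<longleftrightarrow>
        (\<forall>i\<in>{pos..<pos + k}. R i \<omega> \<in> B i)"
      by (auto simp: B_def)
    with False show "\<omega> \<in> ?E \<longleftrightarrow> \<omega> \<in> ?F"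
      by (auto simp: bits_value_eq_iff[OF assms])
  qed
  also have "prob \<dots> = (\<Prod>i\<in>{pos..<pos + k}. prob (R i -` B i \<inter> space M))"
    using False by (intro indep_varsD[OF indep_bits]) auto
  also have "\<dots> = (\<Prod>i\<in>{pos..<pos + k}. 1 / 2)"
    by (intro prod.cong refl, subst prob_uniform[OF measurable_bit _ _ uniform_bit])
       (auto simp: B_def card_UNIV_bool)
  finally show ?thesis by (simp add: power_one_over)
qed

lemma distr_block:
  "distr M (count_space UNIV) (\<lambda>\<omega>. bits_value (\<lambda>n. R n \<omega>) pos k) =
    measure_pmf (pmf_of_set {..<2 ^ k})"
proof (rule measure_eqI_countable[where A = UNIV])
  fix v :: nat
  let ?V = "\<lambda>\<omega>. bits_value (\<lambda>n. R n \<omega>) pos k"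
  have "prob (?V -` {v} \<inter> space M) = pmf (pmf_of_set {..<2 ^ k}) v"
  proof (cases "v < 2 ^ k")
    case False
    then have "?V -` {v} \<inter> space M = {}" using bits_value_less[of _ pos k] by auto
    with False show ?thesis by (simp add: lessThan_empty_iff pmf_of_set)
  qed (simp add: prob_block lessThan_empty_iff)
  then show "emeasure (distr M (count_space UNIV) ?V) {v} =
      emeasure (measure_pmf (pmf_of_set {..<2 ^ k})) {v}"
    by (simp add: emeasure_distr measurable_block emeasure_eq_measure emeasure_pmf_single)
qed auto

text \<open>Distinct blocks read disjoint intervals of the source, and functions of disjoint groups
  of independent variables are independent.\<close>

lemma indep_blocks:
  "indep_vars (\<lambda>_. count_space UNIV) (\<lambda>n \<omega>. bits_value (\<lambda>i. R i \<omega>) (n * k) k) UNIV"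
proof -
  let ?I = "\<lambda>n. {n * k..<n * k + k}"
  \<comment> \<open>A position determines its block by division, so the intervals are
    disjoint.\<close>
  have div: "i div k = n" if "i \<in> ?I n" for i n
    using that by (intro div_nat_eqI) (auto simp: algebra_simps)
  have "disjoint_family ?I"
    unfolding disjoint_family_on_def using div by blast
  then have "indep_vars (\<lambda>n. PiM (?I n) (\<lambda>_. count_space UNIV))
      (\<lambda>n \<omega>. restrict (\<lambda>i. R i \<omega>) (?I n)) UNIV"
    using indep_vars_restrict[OF indep_bits, of UNIV ?I] by simp
  then have "indep_vars (\<lambda>_. count_space UNIV)
      (\<lambda>n \<omega>. bits_value (restrict (\<lambda>i. R i \<omega>) (?I n)) (n * k) k) UNIV"
    by (rule indep_vars_compose2)
       (intro measurable_bits_value measurable_component_singleton, auto)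
  \<comment> \<open>A block value depends only on bits in its own interval, so the restriction does
    not change it.\<close>
  moreover have "bits_value (restrict (\<lambda>i. R i \<omega>) (?I n)) (n * k) k =
      bits_value (\<lambda>i. R i \<omega>) (n * k) k" for n \<omega>
    by (rule bits_value_cong) simp
  ultimately show ?thesis by simp
qed

end

section \<open>Inverse Horner decomposition\<close>

lemma num_tuples_0 [simp]: "num_tuples b 0 = 1"
  by (simp add: num_tuples_def)

lemma num_tuples_Suc: "num_tuples b (Suc L) = num_tuples b L * b (Suc L)"
  by (simp add: num_tuples_def)

lemma num_tuples_pos: "(\<And>i. i \<in> {1..L} \<Longrightarrow> b i > 0) \<Longrightarrow> num_tuples b L > 0"
  by (simp add: num_tuples_def)

text \<open>Makes the accepted values a subset of the possible block values, as
  \<open>distr_first_in\<close> demands.\<close>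

lemma num_tuples_le_block: "num_tuples b L > 0 \<Longrightarrow> num_tuples b L \<le> 2 ^ block_length b L"
proof -
  assume pos: "num_tuples b L > 0"
  have "log 2 (real (num_tuples b L)) \<le> real (block_length b L)"
    unfolding block_length_def by linarith
  then have "real (num_tuples b L) \<le> 2 powr real (block_length b L)"
    using pos by (simp add: log_le_iff)
  then have "real (num_tuples b L) \<le> real (2 ^ block_length b L)"
    by (simp add: powr_realpow)
  then show ?thesis by (simp only: of_nat_le_iff)
qed

lemma inverse_horner_in_PiE:
  assumes "\<And>i. i \<in> {1..L} \<Longrightarrow> b i > 0"
  shows "inverse_horner b L V \<in> (\<Pi>\<^sub>E i\<in>{1..L}. {0..<b i})"
  using assms
proof (induction L arbitrary: V)
  case (Suc L)
  have "{1..Suc L} = insert (Suc L) {1..L}" by auto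
  moreover have "V mod b (Suc L) \<in> {0..<b (Suc L)}" using Suc.prems[of "Suc L"] by simp
  moreover have "inverse_horner b L (V div b (Suc L)) \<in> (\<Pi>\<^sub>E i\<in>{1..L}. {0..<b i})"
    using Suc.prems by (intro Suc.IH) simp
  ultimately show ?case by (simp only: inverse_horner.simps PiE_fun_upd)
qed simp

text \<open>The last digit is the remainder of \<open>V\<close>, and the other digits determine the
  quotient by induction; together they give back \<open>V\<close>.\<close>

lemma inj_on_inverse_horner: "inj_on (inverse_horner b L) {..<num_tuples b L}"
proof (induction L)
  case (Suc L)
  show ?case
  proof (rule inj_onI)
    fix V W assume V: "V \<in> {..<num_tuples b (Suc L)}" and W: "W \<in> {..<num_tuples b (Suc L)}"
      and eq: "inverse_horner b (Suc L) V = inverse_horner b (Suc L) W"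
    \<comment> \<open>The update at \<open>Suc L\<close> hides what the recursive results are there.
      Both are \<open>undefined\<close> at that index, so they agree as functions.\<close>
    have undef: "inverse_horner b i U j = undefined" if "j > i" for i j U
      using that by (induction i arbitrary: U) auto
    have mod: "V mod b (Suc L) = W mod b (Suc L)"
      using fun_cong[OF eq, of "Suc L"] by simp
    have "inverse_horner b L (V div b (Suc L)) = inverse_horner b L (W div b (Suc L))"
    proof
      fix j show "inverse_horner b L (V div b (Suc L)) j = inverse_horner b L (W div b (Suc L)) j"
        using fun_cong[OF eq, of j] by (cases "j = Suc L") (auto simp: undef)
    qed
    moreover have "V div b (Suc L) < num_tuples b L" "W div b (Suc L) < num_tuples b L"
      using V W by (auto simp: num_tuples_Suc intro!: less_mult_imp_div_less)
    ultimately have "V div b (Suc L) = W div b (Suc L)"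
      using Suc.IH by (auto dest: inj_onD)
    with mod show "V = W" by (metis div_mult_mod_eq)
  qed
qed (simp add: inj_on_def)

text \<open>Surjectivity by counting: the injective image lies in the finite set of tuples and has
  the same cardinality.\<close>

lemma bij_betw_inverse_horner:
  assumes "\<And>i. i \<in> {1..L} \<Longrightarrow> b i > 0"
  shows "bij_betw (inverse_horner b L) {..<num_tuples b L} (\<Pi>\<^sub>E i\<in>{1..L}. {0..<b i})"
proof -
  have "inverse_horner b L ` {..<num_tuples b L} = (\<Pi>\<^sub>E i\<in>{1..L}. {0..<b i})"
  proof (rule card_subset_eq)
    show "card (inverse_horner b L ` {..<num_tuples b L}) = card (\<Pi>\<^sub>E i\<in>{1..L}. {0..<b i})"
      using card_image[OF inj_on_inverse_horner, of b L] by (simp add: card_PiE num_tuples_def)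
    show "inverse_horner b L ` {..<num_tuples b L} \<subseteq> (\<Pi>\<^sub>E i\<in>{1..L}. {0..<b i})"
      using inverse_horner_in_PiE[of L b, OF assms] by blast
  qed (simp add: finite_PiE)
  then show ?thesis by (simp add: bij_betw_def inj_on_inverse_horner)
qed

section \<open>The rejection sampler\<close>

lemma rejection_loop_accept:
  assumes "bits_value r pos (block_length b L) < num_tuples b L"
  shows "rejection_loop b L r pos =
    Some (inverse_horner b L (bits_value r pos (block_length b L)))"
  using assms by (subst rejection_loop.simps) (simp add: Let_def)

lemma rejection_loop_reject:
  assumes "num_tuples b L \<le> bits_value r pos (block_length b L)"
  shows "rejection_loop b L r pos = rejection_loop b L r (pos + block_length b L)"
  using assms by (subst rejection_loop.simps) (simp add: Let_def)

text \<open>Read contrapositively, this is nontermination: if every block is rejected, the loop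
  yields \<open>None\<close>. Fixed-point induction applies because the claim only concerns runs
  that return a result.\<close>

lemma rejection_loop_SomeD:
  assumes "rejection_loop b L r pos = Some y"
  shows "\<exists>n. bits_value r (pos + n * block_length b L) (block_length b L) < num_tuples b L"
  using assms
proof (induction rule: rejection_loop.raw_induct[rotated, consumes 1])
  case (1 loop b L r pos y)
  let ?k = "block_length b L"
  show ?case
  proof (cases "bits_value r pos ?k < num_tuples b L")
    case True
    then show ?thesis by (intro exI[of _ 0]) simp
  next
    case False
    \<comment> \<open>The current block is rejected, so the result comes from the approximation
      \<open>loop\<close> started one block later; its witness \<open>n\<close> becomes
      \<open>Suc n\<close>.\<close>
    then have "loop b L r (pos + ?k) = Some y" using 1(2) by (simp add: Let_def)
    from 1(1)[OF this] obtain n where "bits_value r (pos + ?k + n * ?k) ?k < num_tuples b L"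
      by blast
    then show ?thesis by (intro exI[of _ "Suc n"]) (simp add: add_ac)
  qed
qed

lemma rejection_sampler_eq_first_in:
  fixes b L r
  defines "k \<equiv> block_length b L"
  shows "rejection_sampler b L r =
    map_option (inverse_horner b L) (first_in {..<num_tuples b L} (\<lambda>n. bits_value r (n * k) k))"
    (is "_ = map_option _ (first_in ?A ?v)")
proof (cases "first_in ?A ?v")
  case None
  then have "rejection_loop b L r 0 \<noteq> Some y" for y
    using rejection_loop_SomeD[of b L r 0 y] by (auto simp: first_in_eq_None_iff k_def)
  with None show ?thesis by (cases "rejection_loop b L r 0") (auto simp: rejection_sampler_def)
next
  case (Some x)
  then obtain n where n: "?v n = x" "x \<in> ?A" and rej: "\<And>m. m < n \<Longrightarrow> ?v m \<notin> ?A"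
    by (elim first_in_eq_SomeE) auto
  \<comment> \<open>Skipping rejected blocks leaves the result unchanged. This reaches block
    \<open>n\<close>, the first accepted one.\<close>
  have "m \<le> n \<Longrightarrow> rejection_loop b L r 0 = rejection_loop b L r (m * k)" for m
  proof (induction m)
    case (Suc m)
    then show ?case
      using rej[of m] rejection_loop_reject[of b L r "m * k"] by (simp add: k_def add_ac)
  qed simp
  from this[of n] show ?thesis
    using n Some rejection_loop_accept[of r "n * k" b L]
    by (simp add: rejection_sampler_def k_def)
qed

text \<open>Independence of the coordinates depends only on the law of \<open>K\<close>: it says
  that the joint law is the product of the marginals, and all of these are images of that law. This
  moves the question to the concrete measure \<open>p\<close>.\<close>

lemma (in prob_space) indep_vars_coordinates_distr:
  assumes K: "K \<in> measurable M (count_space UNIV)" and I: "I \<noteq> {}"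
    and D: "distr M (count_space UNIV) K = measure_pmf p"
    and ind: "prob_space.indep_vars (measure_pmf p) (\<lambda>_. count_space UNIV) (\<lambda>i f. f i) I"
  shows "indep_vars (\<lambda>_. count_space UNIV) (\<lambda>i \<omega>. K \<omega> i) I"
proof -
  have Ki: "(\<lambda>\<omega>. K \<omega> i) \<in> measurable M (count_space UNIV)" for i
    by (rule measurable_compose[OF K]) simp
  have "distr M (PiM I (\<lambda>_. count_space UNIV)) (\<lambda>\<omega>. \<lambda>i\<in>I. K \<omega> i) =
      distr (distr M (count_space UNIV) K) (PiM I (\<lambda>_. count_space UNIV)) (\<lambda>f. \<lambda>i\<in>I. f i)"
    by (subst distr_distr[OF _ K]) (auto simp: o_def space_PiM)
  also have "\<dots> = PiM I (\<lambda>i. distr (measure_pmf p) (count_space UNIV) (\<lambda>f. f i))"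
    unfolding D
    using ind prob_space.indep_vars_iff_distr_eq_PiM'[OF prob_space_measure_pmf I,
        where X = "\<lambda>i f. f i" and M' = "\<lambda>_. count_space UNIV", of p]
    by simp
  also have "\<dots> = PiM I (\<lambda>i. distr M (count_space UNIV) (\<lambda>\<omega>. K \<omega> i))"
    unfolding D[symmetric] by (subst distr_distr[OF _ K]) (auto simp: o_def)
  finally show ?thesis
    using Ki by (subst indep_vars_iff_distr_eq_PiM'[OF I]) auto
qed

theorem theorem3p4:
  fixes M :: "'a measure" and R :: "nat \<Rightarrow> 'a \<Rightarrow> bool"
    and L :: nat and b :: "nat \<Rightarrow> nat"
  assumes "prob_space M"
    and "prob_space.indep_vars M (\<lambda>_. count_space UNIV) R UNIV"
    and "\<And>n. distr M (count_space UNIV) (R n) = measure_pmf (pmf_of_set UNIV)"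
    and "L \<ge> 1"
    and "\<And>i. i \<in> {1..L} \<Longrightarrow> b i \<ge> 2"
  shows "let S = (\<lambda>\<omega>. rejection_sampler b L (\<lambda>n. R n \<omega>));
             K = (\<lambda>\<omega>. the (S \<omega>))
         in (AE \<omega> in M. S \<omega> \<noteq> None) \<and>
            K \<in> measurable M (count_space UNIV) \<and>
            distr M (count_space UNIV) K = measure_pmf (pmf_of_set (\<Pi>\<^sub>E i\<in>{1..L}. {0..<b i})) \<and>
            prob_space.indep_vars M (\<lambda>_. count_space UNIV) (\<lambda>i \<omega>. K \<omega> i) {1..L}"
proof -
  interpret random_bits M R
    using assms(1-3) by (simp add: random_bits_def random_bits_axioms_def)
  define S where "S = (\<lambda>\<omega>. rejection_sampler b L (\<lambda>n. R n \<omega>))"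
  define K where "K = (\<lambda>\<omega>. the (S \<omega>))"
  define k where "k = block_length b L"
  define P where "P = num_tuples b L"
  define Z where "Z = (\<lambda>\<omega>. first_in {..<P} (\<lambda>n. bits_value (\<lambda>i. R i \<omega>) (n * k) k))"
  \<comment> \<open>A total function, with the unspecified value \<open>the None\<close> at
    \<open>None\<close>. Thus \<open>K\<close> is a function of \<open>Z\<close> everywhere, also
    where the loop does not stop.\<close>
  define h where "h z = the (map_option (inverse_horner b L) z)" for z
  have bpos: "b i > 0" if "i \<in> {1..L}" for i using assms(5)[OF that] by simp
  have P: "0 < P" "P \<le> 2 ^ k"
    using num_tuples_pos[of L b] num_tuples_le_block[of b L] bpos by (auto simp: P_def k_def)
  have S_Z: "S = (\<lambda>\<omega>. map_option (inverse_horner b L) (Z \<omega>))"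
    by (simp add: S_def Z_def P_def k_def rejection_sampler_eq_first_in)
  have K_Z: "K = (\<lambda>\<omega>. h (Z \<omega>))"
    by (simp add: K_def S_Z h_def)
  have Z: "Z \<in> measurable M (count_space UNIV)"
    unfolding Z_def by (intro measurable_first_in measurable_block)
  have D: "distr M (count_space UNIV) Z = measure_pmf (pmf_of_set (Some ` {..<P}))"
    unfolding Z_def using P by (intro distr_first_in[OF indep_blocks _ _ _ distr_block]) auto
  have K: "K \<in> measurable M (count_space UNIV)"
    unfolding K_Z by (rule measurable_compose[OF Z]) simp
  have bij: "bij_betw h (Some ` {..<P}) (\<Pi>\<^sub>E i\<in>{1..L}. {0..<b i})"
    using bij_betw_inverse_horner[of L b, OF bpos]
    by (auto simp: bij_betw_def inj_on_def h_def P_def image_image)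
  have DK: "distr M (count_space UNIV) K = measure_pmf (pmf_of_set (\<Pi>\<^sub>E i\<in>{1..L}. {0..<b i}))"
  proof -
    have "distr M (count_space UNIV) K = distr (distr M (count_space UNIV) Z) (count_space UNIV) h"
      unfolding K_Z by (subst distr_distr[OF _ Z]) (auto simp: o_def)
    also have "\<dots> = measure_pmf (map_pmf h (pmf_of_set (Some ` {..<P})))"
      by (simp add: D map_pmf_rep_eq)
    \<comment> \<open>The image of a uniform distribution under a bijection is uniform.\<close>
    also have "map_pmf h (pmf_of_set (Some ` {..<P})) = pmf_of_set (\<Pi>\<^sub>E i\<in>{1..L}. {0..<b i})"
      using P by (intro map_pmf_of_set_bij_betw bij) auto
    finally show ?thesis .
  qed
  \<comment> \<open>Termination is read off the law of \<open>Z\<close>, whose support does not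
    contain \<open>None\<close>.\<close>
  have "AE z in distr M (count_space UNIV) Z. z \<noteq> None"
    unfolding D using P by (subst AE_measure_pmf_iff, subst set_pmf_of_set) auto
  then have AE: "AE \<omega> in M. S \<omega> \<noteq> None"
    using Z by (subst (asm) AE_distr_iff) (auto simp: S_Z)
  \<comment> \<open>The uniform law on the tuples is the product of the uniform laws of the digits.
    The default \<open>undefined\<close> matches the value outside \<open>{1..L}\<close> in the
    extensional product.\<close>
  have "Pi_pmf {1..L} undefined (\<lambda>i. pmf_of_set {0..<b i}) = pmf_of_set (\<Pi>\<^sub>E i\<in>{1..L}. {0..<b i})"
  proof -
    have "PiE_dflt {1..L} undefined (\<lambda>i. {0..<b i}) = (\<Pi>\<^sub>E i\<in>{1..L}. {0..<b i})"
      by (auto simp: PiE_dflt_def PiE_def extensional_def Pi_def)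
    with bpos show ?thesis by (subst Pi_pmf_of_set) force+
  qed
  then have "prob_space.indep_vars (measure_pmf (pmf_of_set (\<Pi>\<^sub>E i\<in>{1..L}. {0..<b i})))
      (\<lambda>_. count_space UNIV) (\<lambda>i f. f i) {1..L}"
    using indep_vars_Pi_pmf[of "{1..L}" undefined "\<lambda>i. pmf_of_set {0..<b i}"] by simp
  \<comment> \<open>Here \<open>L \<ge> 1\<close> makes the index set nonempty.\<close>
  then have "indep_vars (\<lambda>_. count_space UNIV) (\<lambda>i \<omega>. K \<omega> i) {1..L}"
    using assms(4) by (intro indep_vars_coordinates_distr[OF K _ DK]) auto
  with AE K DK show ?thesis unfolding Let_def S_def K_def by blast
qed

end
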